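(* Let $I$ be a positive integer, let $\mathcal{P}=\mathcal{P}_1\times\dots\times\mathcal{P}_I$ where each $\mathcal{P}_i$ is a finite subset of $\mathbb{R}_+$, and let $\mathbf{u}=(\boldsymbol{\alpha},\boldsymbol{\beta},\boldsymbol{\gamma})$ with $\boldsymbol{\alpha},\boldsymbol{\beta}\in\mathbb{R}^I$ and $\boldsymbol{\gamma}=(\gamma_{i,j})_{i\ne j}\in\mathbb{R}^{I(I-1)}$. Let $$R(\mathbf{p},\mathbf{u}) = \sum_{i=1}^I p_i\, e^{\alpha_i-\beta_i p_i+\sum_{j\ne i}\gamma_{i,j}p_j}$$ be the semi-log revenue function. Then $\max_{\mathbf{p}\in\mathcal{P}} \log R(\mathbf{p},\mathbf{u})$ equals the optimal objective value $Z'$ of the following mixed-integer convex program in the variables $\mu_i$ ($i\in[I]$), $w_{i,j,t}$ ($i,j\in[I]$, $t\in\mathcal{P}_j$), $x_{i,t}$ ($i\in[I]$, $t\in\mathcal{P}_i$): $$\text{maximize}\quad \sum_{i=1}^I \mu_i\alpha_i + \sum_{i=1}^I\sum_{t\in\mathcal{P}_i} \log t\cdot w_{i,i,t} - \sum_{i=1}^I \beta_i\sum_{t\in\mathcal{P}_i} t\cdot w_{i,i,t} + \sum_{i=1}^I\sum_{j\ne i}\gamma_{i,j}\sum_{t\in\mathcal{P}_j} t\cdot w_{i,j,t} - \sum_{i=1}^I \mu_i\log\mu_i$$ subject to $\sum_{t\in\mathcal{P}_j} w_{i,j,t}=\mu_i$ for all $i,j\in[I]$; $\sum_{i=1}^I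 w_{i,j,t}=x_{j,t}$ for all $j\in[I]$, $t\in\mathcal{P}_j$; $\sum_{i=1}^I\mu_i=1$; $\sum_{t\in\mathcal{P}_i}x_{i,t}=1$ for all $i\in[I]$; $w_{i,j,t}\ge 0$ for all $i,j\in[I]$, $t\in\mathcal{P}_j$; $x_{i,t}\in\{0,1\}$ for all $i\in[I]$, $t\in\mathcal{P}_i$; $\mu_i\ge0$ for all $i\in[I]$. Consequently, the optimal objective value of the untransformed problem $\max_{\mathbf{p}\in\mathcal{P}} R(\mathbf{p},\mathbf{u})$ is $e^{Z'}$.
   Context: $[I]=\{1,\dots,I\}$, and $\mathbb{R}_+$ is the set of nonnegative real numbers. In the entropy term, $0\log 0$ is read as $0$, as usual. The set $\mathcal{P}$ is the set of feasible price vectors for $I$ products, and $x_{i,t}=1$ indicates that product $i$ is given price $t$. *)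

theory Defs
  imports "HOL-Analysis.Analysis"
begin

text \<open>
  Prices may be \<open>0\<close>, so \<open>log t\<close> and \<open>log R\<close> may be \<open>-\<infinity>\<close>. The HOL convention
  \<open>ln 0 = 0\<close> would change the value of the program, hence logarithms are taken in \<^typ>\<open>ereal\<close>.
\<close>

definition ln_ereal :: "real \<Rightarrow> ereal" where
  "ln_ereal t = (if 0 < t then ereal (ln t) else - \<infinity>)"

definition exp_ereal :: "ereal \<Rightarrow> ereal" where
  "exp_ereal z = (case z of ereal r \<Rightarrow> ereal (exp r) | PInfty \<Rightarrow> \<infinity> | MInfty \<Rightarrow> 0)"

definition price_vectors :: "nat \<Rightarrow> (nat \<Rightarrow> real set) \<Rightarrow> (nat \<Rightarrow> real) set" where
  "price_vectors I P = (\<Pi>\<^sub>E i\<in>{1..I}. P i)"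

definition semilog_revenue ::
  "nat \<Rightarrow> (nat \<Rightarrow> real) \<Rightarrow> (nat \<Rightarrow> real) \<Rightarrow> (nat \<Rightarrow> nat \<Rightarrow> real) \<Rightarrow> (nat \<Rightarrow> real) \<Rightarrow> real" where
  "semilog_revenue I \<alpha> \<beta> \<gamma> p =
     (\<Sum>i\<in>{1..I}. p i * exp (\<alpha> i - \<beta> i * p i + (\<Sum>j\<in>{1..I} - {i}. \<gamma> i j * p j)))"

type_synonym micp_vars = "(nat \<Rightarrow> real) \<times> (nat \<Rightarrow> nat \<Rightarrow> real \<Rightarrow> real) \<times> (nat \<Rightarrow> real \<Rightarrow> real)"

text \<open>
  A point is a triple \<open>(\<mu>, w, x)\<close> of total functions; constraints and objective only read them
  at indices \<open>i, j \<in> {1..I}\<close> and prices in the corresponding \<open>P j\<close>.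
\<close>

definition micp_feasible :: "nat \<Rightarrow> (nat \<Rightarrow> real set) \<Rightarrow> micp_vars set" where
  "micp_feasible I P = {(\<mu>, w, x).
     (\<forall>i\<in>{1..I}. \<forall>j\<in>{1..I}. (\<Sum>t\<in>P j. w i j t) = \<mu> i) \<and>
     (\<forall>j\<in>{1..I}. \<forall>t\<in>P j. (\<Sum>i\<in>{1..I}. w i j t) = x j t) \<and>
     (\<Sum>i\<in>{1..I}. \<mu> i) = 1 \<and>
     (\<forall>i\<in>{1..I}. (\<Sum>t\<in>P i. x i t) = 1) \<and>
     (\<forall>i\<in>{1..I}. \<forall>j\<in>{1..I}. \<forall>t\<in>P j. 0 \<le> w i j t) \<and>
     (\<forall>i\<in>{1..I}. \<forall>t\<in>P i. x i t \<in> {0, 1}) \<and>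
     (\<forall>i\<in>{1..I}. 0 \<le> \<mu> i)}"

text \<open>
  In \<^typ>\<open>ereal\<close>, \<open>-\<infinity> * 0 = 0\<close>, so at \<open>t = 0\<close> the term \<open>log t * w i i t\<close> is \<open>0\<close> if
  \<open>w i i t = 0\<close> and \<open>-\<infinity>\<close> if \<open>w i i t > 0\<close>; no \<open>\<infinity>\<close> occurs at feasible points.
  The entropy term satisfies \<open>0 log 0 = 0\<close>.
\<close>

definition micp_objective ::
  "nat \<Rightarrow> (nat \<Rightarrow> real set) \<Rightarrow> (nat \<Rightarrow> real) \<Rightarrow> (nat \<Rightarrow> real) \<Rightarrow> (nat \<Rightarrow> nat \<Rightarrow> real) \<Rightarrow>
   micp_vars \<Rightarrow> ereal" where
  "micp_objective I P \<alpha> \<beta> \<gamma> = (\<lambda>(\<mu>, w, x).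
     ereal (\<Sum>i\<in>{1..I}. \<mu> i * \<alpha> i)
     + (\<Sum>i\<in>{1..I}. \<Sum>t\<in>P i. ln_ereal t * ereal (w i i t))
     - ereal (\<Sum>i\<in>{1..I}. \<beta> i * (\<Sum>t\<in>P i. t * w i i t))
     + ereal (\<Sum>i\<in>{1..I}. \<Sum>j\<in>{1..I} - {i}. \<gamma> i j * (\<Sum>t\<in>P j. t * w i j t))
     - ereal (\<Sum>i\<in>{1..I}. \<mu> i * ln (\<mu> i)))"

definition micp_value ::
  "nat \<Rightarrow> (nat \<Rightarrow> real set) \<Rightarrow> (nat \<Rightarrow> real) \<Rightarrow> (nat \<Rightarrow> real) \<Rightarrow> (nat \<Rightarrow> nat \<Rightarrow> real) \<Rightarrow> ereal" where
  "micp_value I P \<alpha> \<beta> \<gamma> = (SUP v\<in>micp_feasible I P. micp_objective I P \<alpha> \<beta> \<gamma> v)"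

end

theory Submission
  imports Defs
begin

text \<open>
  Integrality of \<open>x\<close> selects one price \<open>p j\<close> per product, and then the linear constraints force
  \<open>w i j t = \<mu> i\<close> for \<open>t = p j\<close> and \<open>0\<close> otherwise. The program thus becomes a maximisation over
  \<open>p\<close> and over \<open>\<mu>\<close> in the simplex of \<open>\<Sum>i. \<mu> i * (ln (a i) - ln (\<mu> i))\<close>, where \<open>a i\<close> is the
  \<open>i\<close>-th summand of the revenue. By Gibbs' inequality the maximum over \<open>\<mu>\<close> is \<open>ln (\<Sum>i. a i)\<close>,
  attained at \<open>\<mu> i = a i / (\<Sum>i. a i)\<close>.
\<close>

definition semilog_exponent ::
  "nat \<Rightarrow> (nat \<Rightarrow> real) \<Rightarrow> (nat \<Rightarrow> real) \<Rightarrow> (nat \<Rightarrow> nat \<Rightarrow> real) \<Rightarrow> (nat \<Rightarrow> real) \<Rightarrow> nat \<Rightarrow> real" where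
  "semilog_exponent I \<alpha> \<beta> \<gamma> p i = \<alpha> i - \<beta> i * p i + (\<Sum>j\<in>{1..I} - {i}. \<gamma> i j * p j)"

text \<open>The objective once prices are fixed. The log-price terms stay apart because only they
  can be \<open>-\<infinity>\<close>; \<open>u\<close> stands for the exponents of the revenue
  summands.\<close>

definition entropic_value :: "nat \<Rightarrow> (nat \<Rightarrow> real) \<Rightarrow> (nat \<Rightarrow> real) \<Rightarrow> (nat \<Rightarrow> real) \<Rightarrow> ereal" where
  "entropic_value I p u \<mu> =
     (\<Sum>i\<in>{1..I}. ln_ereal (p i) * ereal (\<mu> i)) + ereal (\<Sum>i\<in>{1..I}. \<mu> i * u i - \<mu> i * ln (\<mu> i))"

text \<open>Here \<open>w i j t\<close> is the product \<open>\<mu> i * x j t\<close>, which the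
  program linearises.\<close>

definition micp_point :: "(nat \<Rightarrow> real) \<Rightarrow> (nat \<Rightarrow> real) \<Rightarrow> micp_vars" where
  "micp_point p \<mu> = (\<mu>, \<lambda>i j t. if t = p j then \<mu> i else 0, \<lambda>j t. if t = p j then 1 else 0)"

lemma mono_ln_ereal: "mono ln_ereal"
  by (rule monoI) (auto simp: ln_ereal_def)

lemma exp_ln_ereal: "0 \<le> r \<Longrightarrow> exp_ereal (ln_ereal r) = ereal r"
  by (auto simp: ln_ereal_def exp_ereal_def simp flip: MInfty_eq_minfinity)

lemma semilog_revenue_eq:
  "semilog_revenue I \<alpha> \<beta> \<gamma> p = (\<Sum>i\<in>{1..I}. p i * exp (semilog_exponent I \<alpha> \<beta> \<gamma> p i))"
  by (simp add: semilog_revenue_def semilog_exponent_def)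

text \<open>In \<open>ereal\<close>, \<open>\<infinity> + -\<infinity>\<close> is
  \<open>\<infinity>\<close>, so \<open>-\<infinity>\<close> absorbs a sum only if no summand is
  \<open>\<infinity>\<close>.\<close>

lemma sum_ereal_eq_MInfty:
  fixes f :: "'a \<Rightarrow> ereal"
  assumes "finite A" "k \<in> A" "f k = -\<infinity>" "\<And>i. i \<in> A \<Longrightarrow> f i \<noteq> \<infinity>"
  shows "sum f A = -\<infinity>"
proof -
  have "sum f (A - {k}) \<noteq> \<infinity>"
    using assms by (simp add: sum_Pinfty)
  then show ?thesis
    using assms by (simp add: sum.remove[of A k f])
qed

section \<open>Entropy maximisation over the simplex at fixed prices\<close>

lemma entropic_value_MInfty:
  assumes "k \<in> {1..I}" "p k \<le> 0" "0 < \<mu> k" "\<And>i. i \<in> {1..I} \<Longrightarrow> 0 \<le> \<mu> i"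
  shows "entropic_value I p u \<mu> = -\<infinity>"
proof -
  have "ln_ereal (p i) * ereal (\<mu> i) \<noteq> \<infinity>" if "i \<in> {1..I}" for i
    using assms(4)[OF that] by (auto simp: ln_ereal_def ereal_mult_eq_PInfty)
  moreover have "ln_ereal (p k) * ereal (\<mu> k) = -\<infinity>"
    using assms by (simp add: ln_ereal_def)
  ultimately have "(\<Sum>i\<in>{1..I}. ln_ereal (p i) * ereal (\<mu> i)) = -\<infinity>"
    using assms(1) by (intro sum_ereal_eq_MInfty[of _ k]) auto
  then show ?thesis
    by (simp add: entropic_value_def)
qed

text \<open>Since \<open>-\<infinity> * 0 = 0\<close>, the real \<open>ln\<close> can replace
  \<open>ln_ereal\<close>: wherever the two differ, the weight is 0.\<close>

lemma entropic_value_eq_ereal: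
  assumes "\<And>i. i \<in> {1..I} \<Longrightarrow> 0 < p i \<or> \<mu> i = 0"
  shows "entropic_value I p u \<mu> = ereal (\<Sum>i\<in>{1..I}. \<mu> i * (ln (p i) + u i - ln (\<mu> i)))"
proof -
  have "(\<Sum>i\<in>{1..I}. ln_ereal (p i) * ereal (\<mu> i)) = (\<Sum>i\<in>{1..I}. ereal (ln (p i) * \<mu> i))"
    using assms by (intro sum.cong) (force simp: ln_ereal_def)+
  then show ?thesis
    by (simp add: entropic_value_def algebra_simps sum.distrib sum_subtractf)
qed

text \<open>One summand of Gibbs' inequality, from \<open>ln y \<le> y - 1\<close> at
  \<open>y = a / (r * m)\<close>. When the \<open>m\<close> sum to 1 and the \<open>a\<close> sum to
  \<open>r\<close>, the terms \<open>a / r\<close> and \<open>m\<close> cancel in the total, leaving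
  \<open>ln r\<close>.\<close>

lemma mult_ln_ratio_le:
  fixes m a r :: real
  assumes "0 \<le> m" "0 \<le> a" "0 < r" "m = 0 \<or> 0 < a"
  shows "m * (ln a - ln m) \<le> m * ln r + a / r - m"
proof (cases "m = 0")
  case True
  then show ?thesis using assms by simp
next
  case False
  then have pos: "0 < m" "0 < a" using assms by auto
  have "ln (a / (r * m)) \<le> a / (r * m) - 1"
    using pos assms by (intro ln_le_minus_one) simp
  then have "m * ln (a / (r * m)) \<le> m * (a / (r * m) - 1)"
    using pos by (intro mult_left_mono) auto
  also have "\<dots> = a / r - m"
    using pos by (simp add: field_simps)
  also have "ln (a / (r * m)) = ln a - ln r - ln m"
    using pos assms by (simp add: ln_div ln_mult)
  finally show ?thesis
    by (simp add: algebra_simps)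
qed

lemma entropic_value_le:
  assumes p: "\<And>i. i \<in> {1..I} \<Longrightarrow> 0 \<le> p i"
    and \<mu>: "\<And>i. i \<in> {1..I} \<Longrightarrow> 0 \<le> \<mu> i" "(\<Sum>i\<in>{1..I}. \<mu> i) = 1"
  shows "entropic_value I p u \<mu> \<le> ln_ereal (\<Sum>i\<in>{1..I}. p i * exp (u i))"
proof (cases "\<exists>k\<in>{1..I}. p k = 0 \<and> 0 < \<mu> k")
  case True
  then show ?thesis
    using entropic_value_MInfty[of _ I p \<mu> u] \<mu> by fastforce
next
  case False
  then have pos: "0 < p i \<or> \<mu> i = 0" if "i \<in> {1..I}" for i
    using p \<mu> that by force
  define R where "R = (\<Sum>i\<in>{1..I}. p i * exp (u i))"
  \<comment> \<open>Weights of total 1 are not all zero, and in this case a weighted product has a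
    positive price. Hence \<open>R\<close> is positive and can serve as divisor.\<close>
  obtain k where k: "k \<in> {1..I}" "\<mu> k \<noteq> 0"
    using \<mu>(2) by (metis sum.neutral zero_neq_one)
  then have "0 < p k * exp (u k)"
    using pos[of k] by simp
  then have R: "0 < R"
    unfolding R_def using p k by (intro sum_pos2[of _ k]) auto
  have "(\<Sum>i\<in>{1..I}. \<mu> i * (ln (p i) + u i - ln (\<mu> i)))
      \<le> (\<Sum>i\<in>{1..I}. \<mu> i * ln R + p i * exp (u i) / R - \<mu> i)"
  proof (rule sum_mono)
    fix i assume i: "i \<in> {1..I}"
    have "\<mu> i * (ln (p i) + u i - ln (\<mu> i)) = \<mu> i * (ln (p i * exp (u i)) - ln (\<mu> i))"
      using pos[OF i] by (auto simp: ln_mult)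
    also have "\<dots> \<le> \<mu> i * ln R + p i * exp (u i) / R - \<mu> i"
      using pos[OF i] p[OF i] \<mu>(1)[OF i] R by (intro mult_ln_ratio_le) auto
    finally show "\<mu> i * (ln (p i) + u i - ln (\<mu> i)) \<le> \<mu> i * ln R + p i * exp (u i) / R - \<mu> i" .
  qed
  also have "\<dots> = ln R"
    using R \<mu>(2)
    by (simp add: sum.distrib sum_subtractf R_def flip: sum_distrib_right sum_divide_distrib)
  finally show ?thesis
    using R entropic_value_eq_ereal[OF pos, where u = u] by (simp add: ln_ereal_def R_def)
qed

text \<open>Equality in Gibbs' inequality holds when the weights are the shares of the products in
  the revenue.\<close>

lemma entropic_value_attained:
  assumes "0 < I" and p: "\<And>i. i \<in> {1..I} \<Longrightarrow> 0 \<le> p i"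
  obtains \<mu> where "\<And>i. i \<in> {1..I} \<Longrightarrow> 0 \<le> \<mu> i" "(\<Sum>i\<in>{1..I}. \<mu> i) = 1"
    "entropic_value I p u \<mu> = ln_ereal (\<Sum>i\<in>{1..I}. p i * exp (u i))"
proof -
  define R where "R = (\<Sum>i\<in>{1..I}. p i * exp (u i))"
  have "0 \<le> R"
    unfolding R_def using p by (intro sum_nonneg) auto
  then consider "R = 0" | "0 < R" by linarith
  then show thesis
  proof cases
    case 1
    \<comment> \<open>Shares are undefined at zero revenue, but then every price is 0 and both sides
      are \<open>-\<infinity>\<close>. A point mass at product 1 suffices.\<close>
    have I: "1 \<in> {1..I}" using assms(1) by simp
    have "p 1 * exp (u 1) = 0"
      using 1 p I unfolding R_def by (subst (asm) sum_nonneg_eq_0_iff) auto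
    then have "entropic_value I p u (\<lambda>i. if i = 1 then 1 else 0) = -\<infinity>"
      using I by (intro entropic_value_MInfty[of 1]) auto
    then show thesis
      using 1 I by (intro that[of "\<lambda>i. if i = 1 then 1 else 0"]) (auto simp: R_def ln_ereal_def)
  next
    case 2
    define \<mu> where "\<mu> i = p i * exp (u i) / R" for i
    have pos: "0 < p i \<or> \<mu> i = 0" if "i \<in> {1..I}" for i
      using p[OF that] by (auto simp: \<mu>_def)
    have sum1: "(\<Sum>i\<in>{1..I}. \<mu> i) = 1"
      using 2 by (simp add: \<mu>_def R_def flip: sum_divide_distrib)
    have "\<mu> i * (ln (p i) + u i - ln (\<mu> i)) = \<mu> i * ln R" if "i \<in> {1..I}" for i
      using pos[OF that] 2 by (auto simp: \<mu>_def ln_div ln_mult)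
    then have "(\<Sum>i\<in>{1..I}. \<mu> i * (ln (p i) + u i - ln (\<mu> i))) = (\<Sum>i\<in>{1..I}. \<mu> i * ln R)"
      by (rule sum.cong[OF refl])
    also have "\<dots> = ln R"
      using sum1 by (simp flip: sum_distrib_right)
    finally have "entropic_value I p u \<mu> = ln_ereal R"
      using 2 entropic_value_eq_ereal[OF pos, where u = u] by (simp add: ln_ereal_def)
    then show thesis
      using p 2 sum1 by (intro that[of \<mu>]) (auto simp: \<mu>_def R_def)
  qed
qed

section \<open>Feasible points of the program and price vectors\<close>

lemma micp_feasible_cases:
  assumes fin: "\<And>i. i \<in> {1..I} \<Longrightarrow> finite (P i)"
    and feas: "(\<mu>, w, x) \<in> micp_feasible I P"
  obtains p where "p \<in> price_vectors I P"
    "\<And>i j t. i \<in> {1..I} \<Longrightarrow> j \<in> {1..I} \<Longrightarrow> t \<in> P j \<Longrightarrow> w i j t = (if t = p j then \<mu> i else 0)"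
proof -
  have w\<mu>: "\<And>i j. i \<in> {1..I} \<Longrightarrow> j \<in> {1..I} \<Longrightarrow> (\<Sum>t\<in>P j. w i j t) = \<mu> i"
    and wx: "\<And>j t. j \<in> {1..I} \<Longrightarrow> t \<in> P j \<Longrightarrow> (\<Sum>i\<in>{1..I}. w i j t) = x j t"
    and x1: "\<And>j. j \<in> {1..I} \<Longrightarrow> (\<Sum>t\<in>P j. x j t) = 1"
    and w0: "\<And>i j t. i \<in> {1..I} \<Longrightarrow> j \<in> {1..I} \<Longrightarrow> t \<in> P j \<Longrightarrow> 0 \<le> w i j t"
    and x01: "\<And>j t. j \<in> {1..I} \<Longrightarrow> t \<in> P j \<Longrightarrow> x j t \<in> {0, 1}"
    using feas unfolding micp_feasible_def by auto
  \<comment> \<open>Binary entries with sum 1 cannot all be 0.\<close>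
  have "\<exists>t\<in>P j. x j t = 1" if "j \<in> {1..I}" for j
    using x1[OF that] x01[OF that] by (metis empty_iff insert_iff sum.neutral zero_neq_one)
  then obtain q where q: "\<And>j. j \<in> {1..I} \<Longrightarrow> q j \<in> P j \<and> x j (q j) = 1"
    by metis
  have w_eq_0: "w i j t = 0" if "i \<in> {1..I}" "j \<in> {1..I}" "t \<in> P j" "t \<noteq> q j" for i j t
  proof -
    have nonneg: "0 \<le> x j s" if "s \<in> P j" for s
      using x01[OF \<open>j \<in> {1..I}\<close> that] by auto
    \<comment> \<open>The entry at \<open>q j\<close> uses up the total 1, so the other entries
      vanish. Each of them is a sum of nonnegative \<open>w i j t\<close>, which therefore vanish
      too.\<close>
    have "(\<Sum>s\<in>P j - {q j}. x j s) = 0"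
      using x1[of j] q[of j] fin[of j] that by (simp add: sum.remove[of "P j" "q j"])
    then have "x j t = 0"
      using that fin[of j] nonneg by (subst (asm) sum_nonneg_eq_0_iff) auto
    then have "(\<Sum>i\<in>{1..I}. w i j t) = 0"
      using wx that by simp
    then show ?thesis
      using that w0[of _ j t] by (subst (asm) sum_nonneg_eq_0_iff) auto
  qed
  have w_eq_\<mu>: "w i j (q j) = \<mu> i" if "i \<in> {1..I}" "j \<in> {1..I}" for i j
  proof -
    have "(\<Sum>t\<in>P j - {q j}. w i j t) = 0"
      using w_eq_0 that by (intro sum.neutral) auto
    then show ?thesis
      using w\<mu>[OF that] q[of j] fin[of j] that by (simp add: sum.remove[of "P j" "q j"])
  qed
  show thesis
  \<comment> \<open>Elements of \<open>price_vectors\<close> are extensional, hence the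
    restriction.\<close>
  proof (rule that[of "restrict q {1..I}"])
    show "restrict q {1..I} \<in> price_vectors I P"
      using q by (auto simp: price_vectors_def)
  qed (use w_eq_0 w_eq_\<mu> in auto)
qed

lemma micp_point_feasible:
  assumes "\<And>i. i \<in> {1..I} \<Longrightarrow> finite (P i)" "p \<in> price_vectors I P"
    and "\<And>i. i \<in> {1..I} \<Longrightarrow> 0 \<le> \<mu> i" "(\<Sum>i\<in>{1..I}. \<mu> i) = 1"
  shows "micp_point p \<mu> \<in> micp_feasible I P"
proof -
  have "p i \<in> P i" if "i \<in> {1..I}" for i
    using assms(2) that by (auto simp: price_vectors_def)
  then show ?thesis
    using assms(1,3,4) by (auto simp: micp_point_def micp_feasible_def)
qed

text \<open>Each sum over \<open>t\<close> collapses to its term at the selected price.\<close>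

lemma micp_objective_eq:
  assumes fin: "\<And>i. i \<in> {1..I} \<Longrightarrow> finite (P i)" and p: "p \<in> price_vectors I P"
    and w: "\<And>i j t. i \<in> {1..I} \<Longrightarrow> j \<in> {1..I} \<Longrightarrow> t \<in> P j \<Longrightarrow>
      w i j t = (if t = p j then \<mu> i else 0)"
  shows "micp_objective I P \<alpha> \<beta> \<gamma> (\<mu>, w, x) = entropic_value I p (semilog_exponent I \<alpha> \<beta> \<gamma> p) \<mu>"
proof -
  have pP: "p i \<in> P i" if "i \<in> {1..I}" for i
    using p that by (auto simp: price_vectors_def)
  have price: "(\<Sum>t\<in>P j. t * w i j t) = p j * \<mu> i" if "i \<in> {1..I}" "j \<in> {1..I}" for i j
  proof -
    have "(\<Sum>t\<in>P j. t * w i j t) = (\<Sum>t\<in>P j. if t = p j then p j * \<mu> i else 0)"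
      using w that by (intro sum.cong) auto
    then show ?thesis
      using fin[of j] pP[of j] that by simp
  qed
  have log: "(\<Sum>t\<in>P i. ln_ereal t * ereal (w i i t)) = ln_ereal (p i) * ereal (\<mu> i)"
    if "i \<in> {1..I}" for i
  proof -
    have "(\<Sum>t\<in>P i. ln_ereal t * ereal (w i i t))
        = (\<Sum>t\<in>P i. if t = p i then ln_ereal (p i) * ereal (\<mu> i) else 0)"
      using w that by (intro sum.cong) auto
    then show ?thesis
      using fin[of i] pP[of i] that by simp
  qed
  \<comment> \<open>Only \<open>L\<close> can be infinite; naming the real parts lets them be
    regrouped by a case distinction on \<open>L\<close>.\<close>
  define L where "L = (\<Sum>i\<in>{1..I}. ln_ereal (p i) * ereal (\<mu> i))"
  define A B C D where "A = (\<Sum>i\<in>{1..I}. \<mu> i * \<alpha> i)" and "B = (\<Sum>i\<in>{1..I}. \<beta> i * (p i * \<mu> i))"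
    and "C = (\<Sum>i\<in>{1..I}. \<Sum>j\<in>{1..I} - {i}. \<gamma> i j * (p j * \<mu> i))"
    and "D = (\<Sum>i\<in>{1..I}. \<mu> i * ln (\<mu> i))"
  have "micp_objective I P \<alpha> \<beta> \<gamma> (\<mu>, w, x) = ereal A + L - ereal B + ereal C - ereal D"
    unfolding micp_objective_def A_def B_def C_def D_def L_def prod.case
    by (intro arg_cong2[where f = plus] arg_cong2[where f = minus] arg_cong[where f = ereal]
        arg_cong2[where f = times] sum.cong refl price log) auto
  also have "\<dots> = L + ereal (A - B + C - D)"
    by (cases L) auto
  also have "A - B + C - D
      = (\<Sum>i\<in>{1..I}. \<mu> i * semilog_exponent I \<alpha> \<beta> \<gamma> p i - \<mu> i * ln (\<mu> i))"
    unfolding A_def B_def C_def D_def semilog_exponent_def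
    by (simp add: algebra_simps sum.distrib sum_subtractf sum_distrib_left)
  finally show ?thesis
    by (simp add: entropic_value_def L_def)
qed

section \<open>Maximisation over price vectors\<close>

theorem mainTheorem8:
  fixes I :: nat
    and P :: "nat \<Rightarrow> real set"
    and \<alpha> \<beta> :: "nat \<Rightarrow> real"
    and \<gamma> :: "nat \<Rightarrow> nat \<Rightarrow> real"
  assumes "0 < I"
    and "\<And>i. i \<in> {1..I} \<Longrightarrow> finite (P i)"
    and "\<And>i. i \<in> {1..I} \<Longrightarrow> P i \<noteq> {}"
    and "\<And>i. i \<in> {1..I} \<Longrightarrow> P i \<subseteq> {0..}"
  shows "(\<exists>v\<in>micp_feasible I P. micp_objective I P \<alpha> \<beta> \<gamma> v = micp_value I P \<alpha> \<beta> \<gamma>)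
    \<and> Max ((\<lambda>p. ln_ereal (semilog_revenue I \<alpha> \<beta> \<gamma> p)) ` price_vectors I P) = micp_value I P \<alpha> \<beta> \<gamma>
    \<and> ereal (Max (semilog_revenue I \<alpha> \<beta> \<gamma> ` price_vectors I P)) = exp_ereal (micp_value I P \<alpha> \<beta> \<gamma>)"
proof -
  let ?V = "price_vectors I P" and ?R = "semilog_revenue I \<alpha> \<beta> \<gamma>"
  let ?F = "micp_feasible I P" and ?f = "micp_objective I P \<alpha> \<beta> \<gamma>"
  have fin: "finite ?V"
    unfolding price_vectors_def using assms(2) by (intro finite_PiE) auto
  have ne: "?V \<noteq> {}"
    unfolding price_vectors_def using assms(3) by (simp add: PiE_eq_empty_iff)
  have nonneg: "0 \<le> p i" if "p \<in> ?V" "i \<in> {1..I}" for p i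
    using assms(4)[OF that(2)] that by (auto simp: price_vectors_def)
  define M where "M = Max (?R ` ?V)"
  have "Max (ln_ereal ` ?R ` ?V) = ln_ereal M"
    unfolding M_def using mono_ln_ereal fin ne by (intro mono_Max_commute[symmetric]) auto
  then have MaxM: "Max ((\<lambda>p. ln_ereal (?R p)) ` ?V) = ln_ereal M"
    by (simp add: image_image)
  obtain p where p: "p \<in> ?V" "?R p = M"
    using Max_in[of "?R ` ?V"] fin ne unfolding M_def
    by (metis finite_imageI image_is_empty imageE)
  \<comment> \<open>Revenue-maximising prices with their optimal weights give the candidate optimum
    of the program.\<close>
  obtain \<mu> where \<mu>: "\<And>i. i \<in> {1..I} \<Longrightarrow> 0 \<le> \<mu> i" "(\<Sum>i\<in>{1..I}. \<mu> i) = 1"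
    "entropic_value I p (semilog_exponent I \<alpha> \<beta> \<gamma> p) \<mu> = ln_ereal (?R p)"
    using entropic_value_attained[OF assms(1), of p "semilog_exponent I \<alpha> \<beta> \<gamma> p"] nonneg[OF p(1)]
    unfolding semilog_revenue_eq by metis
  have feas: "micp_point p \<mu> \<in> ?F"
    using assms(2) p(1) \<mu>(1,2) by (rule micp_point_feasible)
  have attained: "?f (micp_point p \<mu>) = ln_ereal M"
    unfolding micp_point_def using assms(2) p \<mu>(3) by (subst micp_objective_eq[where p = p]) auto
  \<comment> \<open>A feasible point is bounded by the log-revenue of the price vector that it
    encodes.\<close>
  have upper: "?f v \<le> ln_ereal M" if "v \<in> ?F" for v
  proof -
    obtain \<nu> w x where v: "v = (\<nu>, w, x)"
      by (cases v) auto
    then have F: "(\<nu>, w, x) \<in> ?F"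
      using that by simp
    obtain q where q: "q \<in> ?V"
      "\<And>i j t. i \<in> {1..I} \<Longrightarrow> j \<in> {1..I} \<Longrightarrow> t \<in> P j \<Longrightarrow> w i j t = (if t = q j then \<nu> i else 0)"
      using micp_feasible_cases[OF assms(2) F] by blast
    have "?f v = entropic_value I q (semilog_exponent I \<alpha> \<beta> \<gamma> q) \<nu>"
      unfolding v using assms(2) q by (rule micp_objective_eq)
    also have "\<dots> \<le> ln_ereal (?R q)"
      unfolding semilog_revenue_eq using nonneg[OF q(1)] F
      by (intro entropic_value_le) (auto simp: micp_feasible_def)
    also have "\<dots> \<le> ln_ereal M"
      using fin q(1) by (intro monoD[OF mono_ln_ereal]) (simp add: M_def)
    finally show ?thesis .
  qed
  have val: "micp_value I P \<alpha> \<beta> \<gamma> = ln_ereal M"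
    unfolding micp_value_def
    by (rule antisym) (use upper SUP_upper[OF feas, of ?f] attained in \<open>auto intro: SUP_least\<close>)
  \<comment> \<open>\<open>exp_ereal\<close> inverts \<open>ln_ereal\<close> only on nonnegative
    reals.\<close>
  have "0 \<le> M"
    unfolding p(2)[symmetric] semilog_revenue_eq using nonneg[OF p(1)] by (intro sum_nonneg) auto
  then show ?thesis
    using feas attained MaxM val by (auto simp: exp_ln_ereal M_def[symmetric])
qed

end
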